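(* Let $d\in\{2,3\}$ and let $\Omega\subset\mathbb{R}^d$ be a bounded domain with boundary $\partial\Omega=\Gamma\cup\Gamma'$, $\Gamma\cap\Gamma'=\emptyset$, where $\Gamma$ is the boundary of a bounded domain (the solid). Let $\rho>0$, $m>0$, $\vec c\in\mathbb{R}^d$, $\mathbb{I}$ symmetric positive definite, $\vec n$ the unit normal on $\partial\Omega$ pointing out of $\Omega$, and $\vec J=(\vec x-\vec c)\times\vec n$ on $\Gamma$. Given a triple $(\vec U^*,\vec v^*,\vec\omega^* )$ (a fluid vector field $\vec U^*$ on $\Omega$ and solid linear and angular velocities), let the triple $(\vec U,\vec v,\vec\omega)$ be given by \[ (\vec U^*,\vec v^*,\vec\omega^* )=(\vec U,\vec v,\vec\omega)+\Big(\tfrac1\rho\nabla p,\;-\tfrac1m\int_\Gamma p\,\vec n\,dS,\;-\mathbb{I}^{-1}\int_\Gamma p\,\vec J\,dS\Big) \] for some scalar function $p$ on $\Omega$ (with enough regularity for all the integrals and traces involved to make sense). If $(\vec U,\vec v,\vec\omega)$ satisfies $\nabla\cdot\vec U=0$ in $\Omega$, $\vec U\cdot\vec n=\vec v\cdot\vec n+\vec\omega\cdot\vec J$ on $\Gamma$ and $\vec U\cdot\vec n=0$ on $\Gamma'$, then the decomposition is orthogonal with respect to the inner product $\langle\cdot,\cdot\rangle_E$, i.e. \[ \Big\langle(\vec U,\vec v,\vec\omega),\Big(\tfrac1\rho\nabla p,\;-\tfrac1m\int_\Gamma p\vec n\,dS,\;-\mathbb{I}^{-1}\int_\Gamma p\vec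 J\,dS\Big)\Big\rangle_E=0, \] and the kinetic energy decreases: $E^*\ge E$, where $E^*=\langle(\vec U^*,\vec v^*,\vec\omega^* ),(\vec U^*,\vec v^*,\vec\omega^* )\rangle_E$ and $E=\langle(\vec U,\vec v,\vec\omega),(\vec U,\vec v,\vec\omega)\rangle_E$.
   Context: The inner product on $L^2(\Omega)^d\times\mathbb{R}^d\times\mathbb{R}^d$ is \[ \langle(\vec U^{(1)},\vec v^{(1)},\vec\omega^{(1)}),(\vec U^{(2)},\vec v^{(2)},\vec\omega^{(2)})\rangle_E=\int_\Omega\tfrac12\rho\,\vec U^{(1)}\cdot\vec U^{(2)}\,dx+\tfrac12 m\,\vec v^{(1)}\cdot\vec v^{(2)}+\tfrac12\vec\omega^{(1)}\cdot\mathbb{I}\vec\omega^{(2)}, \] so that $E^*=\int_\Omega\frac12\rho|\vec U^*|^2dx+\frac12m|\vec v^*|^2+\frac12\vec\omega^*\cdot\mathbb{I}\vec\omega^*$. When $d=2$, vectors are embedded in $\mathbb{R}^3$ with zero third component, the angular velocity is $(0,0,\omega)$, planar cross products $a_1b_2-a_2b_1$ are identified with scalars (or vectors on the $z$-axis), and the inertia is a positive scalar. *)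

theory Defs
  imports "HOL-Analysis.Analysis" "HOL-Analysis.Cross3"
begin

text \<open>Partial derivatives via the Frechet derivative.\<close>

definition grad :: "(real^'n \<Rightarrow> real) \<Rightarrow> real^'n \<Rightarrow> real^'n" where
  "grad p x = (\<chi> i. frechet_derivative p (at x) (axis i 1))"

definition divergence :: "(real^'n \<Rightarrow> real^'n) \<Rightarrow> real^'n \<Rightarrow> real" where
  "divergence F x = (\<Sum>i\<in>UNIV. frechet_derivative F (at x) (axis i 1) $ i)"

text \<open>F is continuously differentiable on an open neighbourhood of S.\<close>

definition C1_near :: "(real^'n) set \<Rightarrow> (real^'n \<Rightarrow> 'b::real_normed_vector) \<Rightarrow> bool" where
  "C1_near S F \<longleftrightarrow> (\<exists>U. open U \<and> S \<subseteq> U \<and> (\<forall>x\<in>U. F differentiable (at x)) \<and>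
      (\<forall>i. continuous_on U (\<lambda>x. frechet_derivative F (at x) (axis i 1))))"

text \<open>sigma is the surface measure on the boundary of Omega and n the unit normal
  pointing out of Omega, characterised (as in the measure-theoretic / De Giorgi
  sense) by the Gauss-Green formula for all C^1 fields near the closure.\<close>

definition outward_normal :: "(real^'n) set \<Rightarrow> (real^'n) measure \<Rightarrow> (real^'n \<Rightarrow> real^'n) \<Rightarrow> bool" where
  "outward_normal \<Omega> \<sigma> n \<longleftrightarrow>
     sets \<sigma> = sets borel \<and> finite_measure \<sigma> \<and> emeasure \<sigma> (- frontier \<Omega>) = 0 \<and>
     n \<in> borel_measurable borel \<and> (\<forall>x\<in>frontier \<Omega>. norm (n x) = 1) \<and>
     (\<forall>F. C1_near (closure \<Omega>) F \<longrightarrow>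
        (LINT x:\<Omega>|lebesgue. divergence F x) = (\<integral>x. F x \<bullet> n x \<partial>\<sigma>))"

definition bounded_domain :: "(real^'n) set \<Rightarrow> bool" where
  "bounded_domain S \<longleftrightarrow> open S \<and> bounded S \<and> connected S \<and> S \<noteq> {}"

text \<open>The energy inner product; Iop is the inertia acting on angular velocities.\<close>

definition ipE :: "(real^'n) set \<Rightarrow> real \<Rightarrow> real \<Rightarrow> ('k::real_inner \<Rightarrow> 'k) \<Rightarrow>
     (real^'n \<Rightarrow> real^'n) \<times> (real^'n) \<times> 'k \<Rightarrow> (real^'n \<Rightarrow> real^'n) \<times> (real^'n) \<times> 'k \<Rightarrow> real" where
  "ipE \<Omega> \<rho> m Iop X Y = (case X of (U1, v1, w1) \<Rightarrow> case Y of (U2, v2, w2) \<Rightarrow>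
      (LINT x:\<Omega>|lebesgue. (1/2) * \<rho> * (U1 x \<bullet> U2 x)) + (1/2) * m * (v1 \<bullet> v2) + (1/2) * (w1 \<bullet> Iop w2))"

text \<open>Planar cross product identified with a scalar.\<close>

definition cross2 :: "real^2 \<Rightarrow> real^2 \<Rightarrow> real" where
  "cross2 a b = a$1 * b$2 - a$2 * b$1"

end

theory Submission
  imports Defs
begin

text \<open>Write \<open>X = (U, v, w)\<close> and let \<open>Y\<close> be the pressure triple. By the Gauss-Green formula
  for \<open>p U\<close>, the divergence constraint and the boundary conditions, the fluid part of
  \<open>\<langle>X, Y\<rangle>\<^sub>E\<close> equals half the boundary integral of \<open>p (v \<bullet> n + w \<bullet> J)\<close>; the solid parts of
  \<open>\<langle>X, Y\<rangle>\<^sub>E\<close> are exactly minus that, since \<open>\<bbbI>\<close> cancels \<open>\<bbbI>\<inverse>\<close>. So \<open>X\<^sup>* = X + Y\<close> is an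
  orthogonal sum and \<open>E\<^sup>* = E + \<langle>Y, Y\<rangle>\<^sub>E \<ge> E\<close>.\<close>

section \<open>Continuously differentiable fields\<close>

lemma C1_nearE:
  assumes "C1_near S F"
  obtains V where "open V" "S \<subseteq> V" "\<And>x. x \<in> V \<Longrightarrow> F differentiable (at x)"
    "\<And>i. continuous_on V (\<lambda>x. frechet_derivative F (at x) (axis i 1))"
    "continuous_on V F"
proof -
  obtain V where V: "open V" "S \<subseteq> V" "\<forall>x\<in>V. F differentiable (at x)"
    "\<forall>i. continuous_on V (\<lambda>x. frechet_derivative F (at x) (axis i 1))"
    using assms unfolding C1_near_def by blast
  moreover have "continuous_on V F"
    using V(3) by (simp add: continuous_at_imp_continuous_on differentiable_imp_continuous_within)
  ultimately show ?thesis using that by blast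
qed

lemma C1_near_differentiable: "C1_near S F \<Longrightarrow> x \<in> S \<Longrightarrow> F differentiable (at x)"
  by (erule C1_nearE) blast

lemma C1_near_continuous_on: "C1_near S F \<Longrightarrow> continuous_on S F"
  by (erule C1_nearE) (blast intro: continuous_on_subset)

lemma C1_near_continuous_on_grad: "C1_near S p \<Longrightarrow> continuous_on S (grad p)"
  unfolding grad_def
  by (erule C1_nearE) (intro continuous_on_vec_lambda, blast intro: continuous_on_subset)

lemma has_derivative_scaleR_frechet:
  assumes "p differentiable (at x)" "U differentiable (at x)"
  shows "((\<lambda>y. p y *\<^sub>R U y) has_derivative
           (\<lambda>h. p x *\<^sub>R frechet_derivative U (at x) h + frechet_derivative p (at x) h *\<^sub>R U x)) (at x)"
  using has_derivative_scaleR[OF assms[unfolded frechet_derivative_works]] .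

lemma divergence_scaleR:
  fixes p :: "real^'n \<Rightarrow> real" and U :: "real^'n \<Rightarrow> real^'n"
  assumes "p differentiable (at x)" "U differentiable (at x)"
  shows "divergence (\<lambda>y. p y *\<^sub>R U y) x = p x * divergence U x + grad p x \<bullet> U x"
  unfolding divergence_def grad_def inner_vec_def
    frechet_derivative_at[OF has_derivative_scaleR_frechet[OF assms], symmetric]
  by (simp add: sum.distrib sum_distrib_left)

lemma C1_near_scaleR:
  fixes p :: "real^'n \<Rightarrow> real" and U :: "real^'n \<Rightarrow> 'b::real_normed_vector"
  assumes "C1_near S p" "C1_near S U"
  shows "C1_near S (\<lambda>x. p x *\<^sub>R U x)"
proof -
  obtain Vp where Vp: "open Vp" "S \<subseteq> Vp" "\<And>x. x \<in> Vp \<Longrightarrow> p differentiable (at x)"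
    "\<And>i. continuous_on Vp (\<lambda>x. frechet_derivative p (at x) (axis i 1))" "continuous_on Vp p"
    using C1_nearE[OF assms(1)] by blast
  obtain VU where VU: "open VU" "S \<subseteq> VU" "\<And>x. x \<in> VU \<Longrightarrow> U differentiable (at x)"
    "\<And>i. continuous_on VU (\<lambda>x. frechet_derivative U (at x) (axis i 1))" "continuous_on VU U"
    using C1_nearE[OF assms(2)] by blast
  let ?D = "\<lambda>x h. p x *\<^sub>R frechet_derivative U (at x) h + frechet_derivative p (at x) h *\<^sub>R U x"
  have der: "((\<lambda>y. p y *\<^sub>R U y) has_derivative ?D x) (at x)" if "x \<in> Vp \<inter> VU" for x
    using that Vp(3) VU(3) by (intro has_derivative_scaleR_frechet) auto
  have "continuous_on (Vp \<inter> VU) (\<lambda>x. frechet_derivative (\<lambda>y. p y *\<^sub>R U y) (at x) (axis i 1))"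
    for i
  proof -
    have "continuous_on (Vp \<inter> VU) (\<lambda>x. ?D x (axis i 1))"
      by (intro continuous_intros continuous_on_subset[OF Vp(5)] continuous_on_subset[OF VU(5)]
          continuous_on_subset[OF Vp(4)] continuous_on_subset[OF VU(4)]) auto
    then show ?thesis
      by (rule continuous_on_cong[THEN iffD1, rotated 2]) (auto simp: frechet_derivative_at[OF der, symmetric])
  qed
  moreover have "(\<lambda>y. p y *\<^sub>R U y) differentiable (at x)" if "x \<in> Vp \<inter> VU" for x
    using der[OF that] by (auto simp: differentiable_def)
  ultimately show ?thesis
    unfolding C1_near_def using Vp(1,2) VU(1,2) by (intro exI[of _ "Vp \<inter> VU"]) auto
qed

section \<open>Gauss-Green on the boundary\<close>

lemma frontier_subset_closure: "frontier S \<subseteq> closure S"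
  by (auto simp: frontier_def)

lemma outward_normal_AE_frontier:
  assumes "outward_normal \<Omega> \<sigma> n"
  shows "AE x in \<sigma>. x \<in> frontier \<Omega>"
proof -
  have "- frontier \<Omega> \<in> null_sets \<sigma>"
    using assms by (auto simp: outward_normal_def null_sets_def)
  then show ?thesis using AE_not_in by fastforce
qed

lemma set_borel_measurable_frontier_flux:
  fixes F n :: "real^'n \<Rightarrow> real^'n"
  assumes "sets \<sigma> = sets borel" "continuous_on (frontier \<Omega>) F" "n \<in> borel_measurable borel"
  shows "set_borel_measurable \<sigma> (frontier \<Omega>) (\<lambda>x. F x \<bullet> n x)"
proof -
  have "(\<lambda>x. indicator (frontier \<Omega>) x *\<^sub>R F x) \<in> borel_measurable borel"
    using assms(2) by (intro borel_measurable_continuous_on_indicator) auto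
  then have "(\<lambda>x. (indicator (frontier \<Omega>) x *\<^sub>R F x) \<bullet> n x) \<in> borel_measurable borel"
    using assms(3) by measurable
  then show ?thesis
    unfolding set_borel_measurable_def measurable_cong_sets[OF assms(1) refl] by simp
qed

text \<open>The Gauss-Green formula in \<open>outward_normal\<close> integrates over all of \<open>\<sigma>\<close> and so
  needs a globally measurable field; \<open>F\<close> is cut off outside an open neighbourhood of the
  closure, which changes neither its divergence in \<open>\<Omega>\<close> nor its values on the boundary.\<close>

lemma gauss_green_frontier:
  fixes F :: "real^'n \<Rightarrow> real^'n"
  assumes normal: "outward_normal \<Omega> \<sigma> n" and "open \<Omega>" and F: "C1_near (closure \<Omega>) F"
  shows "(LINT x:\<Omega>|lebesgue. divergence F x) = (LINT x:frontier \<Omega>|\<sigma>. F x \<bullet> n x)"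
proof -
  have \<sigma>: "sets \<sigma> = sets borel" and n: "n \<in> borel_measurable borel"
    using normal unfolding outward_normal_def by auto
  obtain V where V: "open V" "closure \<Omega> \<subseteq> V" "\<And>x. x \<in> V \<Longrightarrow> F differentiable (at x)"
    "\<And>i. continuous_on V (\<lambda>x. frechet_derivative F (at x) (axis i 1))" "continuous_on V F"
    using C1_nearE[OF F] by blast
  define G where "G x = indicator V x *\<^sub>R F x" for x
  have G_der: "(G has_derivative frechet_derivative F (at x)) (at x)" if "x \<in> V" for x
    by (rule has_derivative_transform_within_open[OF _ V(1) that])
      (use V(3)[OF that] frechet_derivative_works in \<open>auto simp: G_def\<close>)
  have "C1_near (closure \<Omega>) G"
    unfolding C1_near_def
  proof (intro exI[of _ V] conjI ballI allI)
    show "G differentiable (at x)" if "x \<in> V" for x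
      using G_der[OF that] by (auto simp: differentiable_def)
    show "continuous_on V (\<lambda>x. frechet_derivative G (at x) (axis i 1))" for i
      by (rule continuous_on_cong[THEN iffD1, rotated 2, OF V(4)])
        (auto simp: frechet_derivative_at[OF G_der])
  qed (use V in auto)
  then have gauss_green: "(LINT x:\<Omega>|lebesgue. divergence G x) = (\<integral>x. G x \<bullet> n x \<partial>\<sigma>)"
    using normal unfolding outward_normal_def by blast
  have "(LINT x:\<Omega>|lebesgue. divergence F x) = (LINT x:\<Omega>|lebesgue. divergence G x)"
  proof (rule set_lebesgue_integral_cong)
    show "\<Omega> \<in> sets lebesgue" using \<open>open \<Omega>\<close> by simp
    show "\<forall>x. x \<in> \<Omega> \<longrightarrow> divergence F x = divergence G x"
    proof (intro allI impI)
      fix x assume "x \<in> \<Omega>"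
      then have "x \<in> V" using V(2) closure_subset by blast
      then show "divergence F x = divergence G x"
        by (simp add: divergence_def frechet_derivative_at[OF G_der[OF \<open>x \<in> V\<close>], symmetric])
    qed
  qed
  also have "\<dots> = (LINT x:frontier \<Omega>|\<sigma>. F x \<bullet> n x)"
    unfolding gauss_green unfolding set_lebesgue_integral_def
  proof (rule integral_cong_AE)
    have "G \<in> borel_measurable borel"
      unfolding G_def using V(1,5) by (intro borel_measurable_continuous_on_indicator) auto
    then show "(\<lambda>x. G x \<bullet> n x) \<in> borel_measurable \<sigma>"
      using n by (simp add: measurable_cong_sets[OF \<sigma> refl])
    show "(\<lambda>x. indicator (frontier \<Omega>) x *\<^sub>R (F x \<bullet> n x)) \<in> borel_measurable \<sigma>"
      using set_borel_measurable_frontier_flux[OF \<sigma> _ n] V(2,5) frontier_subset_closure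
      unfolding set_borel_measurable_def by (blast intro: continuous_on_subset)
    show "AE x in \<sigma>. G x \<bullet> n x = indicator (frontier \<Omega>) x *\<^sub>R (F x \<bullet> n x)"
      using outward_normal_AE_frontier[OF normal]
      by eventually_elim (use V(2) frontier_subset_closure[of \<Omega>] in \<open>auto simp: G_def\<close>)
  qed
  finally show ?thesis .
qed

lemma integral_grad_inner_divergence_free:
  fixes p :: "real^'n \<Rightarrow> real" and U :: "real^'n \<Rightarrow> real^'n"
  assumes normal: "outward_normal \<Omega> \<sigma> n" and "open \<Omega>"
    and p: "C1_near (closure \<Omega>) p" and U: "C1_near (closure \<Omega>) U"
    and div_free: "\<forall>x\<in>\<Omega>. divergence U x = 0"
  shows "(LINT x:\<Omega>|lebesgue. grad p x \<bullet> U x) = (LINT x:frontier \<Omega>|\<sigma>. p x * (U x \<bullet> n x))"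
proof -
  have "(LINT x:\<Omega>|lebesgue. grad p x \<bullet> U x) = (LINT x:\<Omega>|lebesgue. divergence (\<lambda>y. p y *\<^sub>R U y) x)"
  proof (rule set_lebesgue_integral_cong)
    show "\<Omega> \<in> sets lebesgue" using \<open>open \<Omega>\<close> by simp
    show "\<forall>x. x \<in> \<Omega> \<longrightarrow> grad p x \<bullet> U x = divergence (\<lambda>y. p y *\<^sub>R U y) x"
    proof (intro allI impI)
      fix x assume "x \<in> \<Omega>"
      then have "x \<in> closure \<Omega>" using closure_subset by blast
      then show "grad p x \<bullet> U x = divergence (\<lambda>y. p y *\<^sub>R U y) x"
        using div_free \<open>x \<in> \<Omega>\<close>
        by (simp add: divergence_scaleR C1_near_differentiable[OF p] C1_near_differentiable[OF U])
    qed
  qed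
  also have "\<dots> = (LINT x:frontier \<Omega>|\<sigma>. (p x *\<^sub>R U x) \<bullet> n x)"
    by (rule gauss_green_frontier[OF normal \<open>open \<Omega>\<close> C1_near_scaleR[OF p U]])
  finally show ?thesis by simp
qed

lemma set_integral_boundary_data:
  fixes f g :: "'a \<Rightarrow> real"
  assumes concentrated: "AE x in \<sigma>. x \<in> \<Gamma> \<union> \<Gamma>'" and "\<Gamma> \<inter> \<Gamma>' = {}"
    and f: "set_borel_measurable \<sigma> (\<Gamma> \<union> \<Gamma>') f" and g: "set_borel_measurable \<sigma> \<Gamma> g"
    and on_\<Gamma>: "AE x in \<sigma>. x \<in> \<Gamma> \<longrightarrow> f x = g x" and on_\<Gamma>': "AE x in \<sigma>. x \<in> \<Gamma>' \<longrightarrow> f x = 0"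
  shows "(LINT x:\<Gamma> \<union> \<Gamma>'|\<sigma>. f x) = (LINT x:\<Gamma>|\<sigma>. g x)"
  unfolding set_lebesgue_integral_def
proof (rule integral_cong_AE)
  show "(\<lambda>x. indicator (\<Gamma> \<union> \<Gamma>') x *\<^sub>R f x) \<in> borel_measurable \<sigma>"
    "(\<lambda>x. indicator \<Gamma> x *\<^sub>R g x) \<in> borel_measurable \<sigma>"
    using f g unfolding set_borel_measurable_def by auto
  show "AE x in \<sigma>. indicator (\<Gamma> \<union> \<Gamma>') x *\<^sub>R f x = indicator \<Gamma> x *\<^sub>R g x"
    using concentrated on_\<Gamma> on_\<Gamma>' by eventually_elim (use \<open>\<Gamma> \<inter> \<Gamma>' = {}\<close> in auto)
qed

section \<open>Integrability\<close>

lemma set_integrable_continuous_on_closure: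
  fixes f :: "real^'n \<Rightarrow> real"
  assumes "bounded \<Omega>" "open \<Omega>" "continuous_on (closure \<Omega>) f"
  shows "set_integrable lebesgue \<Omega> f"
proof -
  have "integrable lborel (\<lambda>x. indicator (closure \<Omega>) x *\<^sub>R f x)"
    using assms(1,3) by (intro borel_integrable_compact) auto
  moreover have "(\<lambda>x. indicator (closure \<Omega>) x *\<^sub>R f x) \<in> borel_measurable lborel"
    using borel_measurable_continuous_on_indicator[OF _ assms(3)] by simp
  ultimately have "set_integrable lebesgue (closure \<Omega>) f"
    unfolding set_integrable_def using integrable_completion by blast
  moreover have "\<Omega> \<in> sets lebesgue"
    using assms(2) by simp
  ultimately show ?thesis
    by (rule set_integrable_subset) (rule closure_subset)
qed

lemma set_integrable_continuous_scaleR_bounded: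
  fixes p :: "'a::metric_space \<Rightarrow> real" and h :: "'a \<Rightarrow> 'b::{banach,second_countable_topology}"
  assumes "finite_measure \<sigma>" "sets \<sigma> = sets borel" "compact K"
    and "continuous_on K p" "h \<in> borel_measurable borel" "bounded (h ` K)"
  shows "set_integrable \<sigma> K (\<lambda>x. p x *\<^sub>R h x)"
proof -
  have "bounded (p ` K)"
    using compact_continuous_image[OF assms(4,3)] by (rule compact_imp_bounded)
  then obtain P where P: "P > 0" "\<forall>x\<in>K. norm (p x) \<le> P"
    by (auto simp: bounded_pos)
  obtain H where H: "H > 0" "\<forall>x\<in>K. norm (h x) \<le> H"
    using assms(6) by (auto simp: bounded_pos)
  have "(\<lambda>x. indicator K x *\<^sub>R p x) \<in> borel_measurable borel"
    using assms(3,4) by (intro borel_measurable_continuous_on_indicator borel_closed compact_imp_closed)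
  then have "(\<lambda>x. indicator K x *\<^sub>R (p x *\<^sub>R h x)) \<in> borel_measurable \<sigma>"
    using assms(5) by (simp add: measurable_cong_sets[OF assms(2) refl])
  moreover have "norm (indicator K x *\<^sub>R (p x *\<^sub>R h x)) \<le> P * H" for x
  proof (cases "x \<in> K")
    case True
    then have "norm (p x) * norm (h x) \<le> P * H"
      using P H by (intro mult_mono) auto
    then show ?thesis using True by simp
  qed (use P H in simp)
  ultimately show ?thesis
    unfolding set_integrable_def
    by (intro finite_measure.integrable_const_bound[OF assms(1), of _ "P * H"]) auto
qed

lemma set_integral_inner_right:
  fixes f :: "'a \<Rightarrow> 'b::{real_inner,banach,second_countable_topology}"
  assumes "set_integrable M A f"
  shows "(LINT x:A|M. c \<bullet> f x) = c \<bullet> (LINT x:A|M. f x)"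
  using assms unfolding set_integrable_def set_lebesgue_integral_def
  by (simp add: inner_scaleR_right[symmetric] del: inner_scaleR_right)

lemma set_integrable_inner_right:
  fixes f :: "'a \<Rightarrow> 'b::{real_inner,banach,second_countable_topology}"
  assumes "set_integrable M A f"
  shows "set_integrable M A (\<lambda>x. c \<bullet> f x)"
  using integrable_inner_right[of c M "\<lambda>x. indicator A x *\<^sub>R f x"] assms
  unfolding set_integrable_def by simp

lemma bilinear_moment_measurable:
  fixes h :: "'a::euclidean_space \<Rightarrow> 'a \<Rightarrow> 'k::euclidean_space"
  assumes "bilinear h" "n \<in> borel_measurable borel"
  shows "(\<lambda>x. h (x - c) (n x)) \<in> borel_measurable borel"
proof -
  have "continuous_on UNIV (\<lambda>z::'a \<times> 'a. h (fst z) (snd z))"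
    using continuous_on_fst[OF continuous_on_id] continuous_on_snd[OF continuous_on_id] assms(1)
    by (rule bilinear_continuous_on_compose)
  then have "(\<lambda>x. (\<lambda>z::'a \<times> 'a. h (fst z) (snd z)) (x - c, n x)) \<in> borel_measurable borel"
    by (rule borel_measurable_continuous_on) (use assms(2) in measurable)
  then show ?thesis by simp
qed

lemma bilinear_moment_bounded:
  fixes h :: "'a::euclidean_space \<Rightarrow> 'a \<Rightarrow> 'k::euclidean_space"
  assumes "bilinear h" "bounded K" "\<forall>x\<in>K. norm (n x) = 1"
  shows "bounded ((\<lambda>x. h (x - c) (n x)) ` K)"
proof -
  obtain C where C: "C > 0" "\<And>a b. norm (h a b) \<le> norm a * norm b * C"
    using assms(1) bilinear_conv_bounded_bilinear bounded_bilinear.pos_bounded by blast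
  obtain R where R: "\<forall>x\<in>K. norm x \<le> R"
    using assms(2) bounded_iff by blast
  have "norm (h (x - c) (n x)) \<le> (R + norm c) * C" if "x \<in> K" for x
  proof -
    have "norm (x - c) \<le> R + norm c"
      using R that norm_triangle_ineq4[of x c] by fastforce
    then have "norm (x - c) * norm (n x) * C \<le> (R + norm c) * C"
      using assms(3) that C(1) by (simp add: mult_right_mono)
    then show ?thesis using C(2) order_trans by blast
  qed
  then show ?thesis by (auto simp: bounded_iff)
qed

section \<open>The energy inner product\<close>

lemma ipE_pressure_orthogonal:
  fixes Iop Linv :: "'k::real_inner \<Rightarrow> 'k"
  assumes "linear Iop" "\<And>z. Iop (Linv z) = z" "\<rho> \<noteq> 0" "m \<noteq> 0"
    and flux: "(LINT x:\<Omega>|lebesgue. grad p x \<bullet> U x) = v \<bullet> A + w \<bullet> B"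
  shows "ipE \<Omega> \<rho> m Iop (U, v, w) (\<lambda>x. (1/\<rho>) *\<^sub>R grad p x, - (1/m) *\<^sub>R A, - Linv B) = 0"
proof -
  have integrand: "(\<lambda>x. (1/2) * \<rho> * (U x \<bullet> (1/\<rho>) *\<^sub>R grad p x)) = (\<lambda>x. (1/2) * (grad p x \<bullet> U x))"
    using \<open>\<rho> \<noteq> 0\<close> by (simp add: fun_eq_iff inner_commute)
  have fluid: "(LINT x:\<Omega>|lebesgue. (1/2) * \<rho> * (U x \<bullet> (1/\<rho>) *\<^sub>R grad p x))
      = (1/2) * (v \<bullet> A + w \<bullet> B)"
    unfolding integrand set_integral_mult_right flux ..
  show ?thesis
    unfolding ipE_def prod.case fluid using assms(1,2,4) by (simp add: linear_neg algebra_simps)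
qed

lemma ipE_add_self:
  fixes Iop :: "'k::real_inner \<Rightarrow> 'k"
  assumes "linear Iop" and sym: "\<And>a b. a \<bullet> Iop b = b \<bullet> Iop a" and "\<Omega> \<in> sets lebesgue"
    and sum: "\<forall>x\<in>\<Omega>. Ustar x = U x + G x"
    and "set_integrable lebesgue \<Omega> (\<lambda>x. U x \<bullet> U x)" "set_integrable lebesgue \<Omega> (\<lambda>x. U x \<bullet> G x)"
      "set_integrable lebesgue \<Omega> (\<lambda>x. G x \<bullet> G x)"
  shows "ipE \<Omega> \<rho> m Iop (Ustar, v + a, w + b) (Ustar, v + a, w + b)
    = ipE \<Omega> \<rho> m Iop (U, v, w) (U, v, w) + 2 * ipE \<Omega> \<rho> m Iop (U, v, w) (G, a, b)
      + ipE \<Omega> \<rho> m Iop (G, a, b) (G, a, b)"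
proof -
  have "(LINT x:\<Omega>|lebesgue. Ustar x \<bullet> Ustar x)
      = (LINT x:\<Omega>|lebesgue. U x \<bullet> U x + 2 * (U x \<bullet> G x) + G x \<bullet> G x)"
    using sum \<open>\<Omega> \<in> sets lebesgue\<close>
    by (intro set_lebesgue_integral_cong) (auto simp: inner_add_left inner_add_right inner_commute)
  also have "\<dots> = (LINT x:\<Omega>|lebesgue. U x \<bullet> U x) + 2 * (LINT x:\<Omega>|lebesgue. U x \<bullet> G x)
      + (LINT x:\<Omega>|lebesgue. G x \<bullet> G x)"
    using assms(5-7) by simp
  finally show ?thesis
    using sym[of b w] unfolding ipE_def
    by (simp add: linear_add[OF \<open>linear Iop\<close>] inner_add_left inner_add_right inner_commute
        field_simps)
qed

lemma ipE_self_nonneg: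
  assumes "0 \<le> \<rho>" "0 \<le> m" "\<And>a. 0 \<le> a \<bullet> Iop a"
  shows "0 \<le> ipE \<Omega> \<rho> m Iop X X"
proof -
  obtain U v w where X: "X = (U, v, w)" by (cases X) auto
  have "0 \<le> (LINT x:\<Omega>|lebesgue. (1/2) * \<rho> * (U x \<bullet> U x))"
    unfolding set_lebesgue_integral_def
    by (rule integral_nonneg_AE) (use assms(1) in \<open>auto simp: indicator_def\<close>)
  then show ?thesis
    using assms by (simp add: ipE_def X)
qed

section \<open>Pressure projection\<close>

lemma set_integrable_pressure_moments:
  fixes \<Omega> :: "(real^'n) set" and j :: "real^'n \<Rightarrow> real^'n \<Rightarrow> 'k::euclidean_space"
    and p :: "real^'n \<Rightarrow> real"
  assumes "bounded \<Omega>" "frontier \<Omega> = \<Gamma> \<union> \<Gamma>'" "closed \<Gamma>" and normal: "outward_normal \<Omega> \<sigma> n"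
    and "bilinear j" and p: "C1_near (closure \<Omega>) p"
  shows "set_integrable \<sigma> \<Gamma> (\<lambda>x. p x *\<^sub>R n x)"
    and "set_integrable \<sigma> \<Gamma> (\<lambda>x. p x *\<^sub>R j (x - c) (n x))"
proof -
  have \<sigma>: "sets \<sigma> = sets borel" "finite_measure \<sigma>" and n: "n \<in> borel_measurable borel"
    and n_unit: "\<forall>x\<in>\<Gamma>. norm (n x) = 1"
    using normal assms(2) unfolding outward_normal_def by auto
  have \<Gamma>_closure: "\<Gamma> \<subseteq> closure \<Omega>"
    using assms(2) frontier_subset_closure by blast
  then have "compact \<Gamma>"
    using assms(1,3) by (meson bounded_closure bounded_subset compact_eq_bounded_closed)
  moreover have "continuous_on \<Gamma> p"
    using C1_near_continuous_on[OF p] \<Gamma>_closure by (rule continuous_on_subset)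
  moreover have "bounded (n ` \<Gamma>)"
    using n_unit by (auto simp: bounded_iff)
  moreover have "bounded ((\<lambda>x. j (x - c) (n x)) ` \<Gamma>)"
    using \<open>bilinear j\<close> compact_imp_bounded[OF \<open>compact \<Gamma>\<close>] n_unit by (rule bilinear_moment_bounded)
  ultimately show "set_integrable \<sigma> \<Gamma> (\<lambda>x. p x *\<^sub>R n x)"
    and "set_integrable \<sigma> \<Gamma> (\<lambda>x. p x *\<^sub>R j (x - c) (n x))"
    using set_integrable_continuous_scaleR_bounded[OF \<sigma>(2,1)] n
      bilinear_moment_measurable[OF \<open>bilinear j\<close> n] by blast+
qed

text \<open>The power of the pressure on the fluid equals that of the pressure force and torque on the
  rigid motion \<open>(v, w)\<close>.\<close>

lemma integral_grad_inner_rigid_boundary: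
  fixes \<Omega> :: "(real^'n) set" and j :: "real^'n \<Rightarrow> real^'n \<Rightarrow> 'k::euclidean_space"
    and p :: "real^'n \<Rightarrow> real" and U :: "real^'n \<Rightarrow> real^'n"
  assumes "open \<Omega>" "bounded \<Omega>" and parts: "frontier \<Omega> = \<Gamma> \<union> \<Gamma>'" "\<Gamma> \<inter> \<Gamma>' = {}" "closed \<Gamma>"
    and normal: "outward_normal \<Omega> \<sigma> n" and "bilinear j"
    and p: "C1_near (closure \<Omega>) p" and U: "C1_near (closure \<Omega>) U"
    and div_free: "\<forall>x\<in>\<Omega>. divergence U x = 0"
    and on_\<Gamma>: "AE x in \<sigma>. x \<in> \<Gamma> \<longrightarrow> U x \<bullet> n x = v \<bullet> n x + w \<bullet> j (x - c) (n x)"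
    and on_\<Gamma>': "AE x in \<sigma>. x \<in> \<Gamma>' \<longrightarrow> U x \<bullet> n x = 0"
  shows "(LINT x:\<Omega>|lebesgue. grad p x \<bullet> U x)
    = v \<bullet> (LINT x:\<Gamma>|\<sigma>. p x *\<^sub>R n x) + w \<bullet> (LINT x:\<Gamma>|\<sigma>. p x *\<^sub>R j (x - c) (n x))"
proof -
  have \<sigma>: "sets \<sigma> = sets borel" and n: "n \<in> borel_measurable borel"
    using normal unfolding outward_normal_def by auto
  note int_A = set_integrable_pressure_moments(1)[OF \<open>bounded \<Omega>\<close> parts(1,3) normal \<open>bilinear j\<close> p]
  note int_B = set_integrable_pressure_moments(2)[OF \<open>bounded \<Omega>\<close> parts(1,3) normal \<open>bilinear j\<close> p]
  have "(LINT x:\<Omega>|lebesgue. grad p x \<bullet> U x) = (LINT x:\<Gamma> \<union> \<Gamma>'|\<sigma>. p x * (U x \<bullet> n x))"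
    using integral_grad_inner_divergence_free[OF normal \<open>open \<Omega>\<close> p U div_free] parts(1) by simp
  also have "\<dots> = (LINT x:\<Gamma>|\<sigma>. v \<bullet> (p x *\<^sub>R n x) + w \<bullet> (p x *\<^sub>R j (x - c) (n x)))"
  proof (rule set_integral_boundary_data[OF _ parts(2)])
    show "AE x in \<sigma>. x \<in> \<Gamma> \<union> \<Gamma>'"
      using outward_normal_AE_frontier[OF normal] parts(1) by simp
    have "set_borel_measurable \<sigma> (frontier \<Omega>) (\<lambda>x. (p x *\<^sub>R U x) \<bullet> n x)"
      using continuous_on_subset[OF C1_near_continuous_on[OF C1_near_scaleR[OF p U]]
          frontier_subset_closure]
      by (rule set_borel_measurable_frontier_flux[OF \<sigma> _ n])
    then show "set_borel_measurable \<sigma> (\<Gamma> \<union> \<Gamma>') (\<lambda>x. p x * (U x \<bullet> n x))"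
      using parts(1) by simp
    have "set_integrable \<sigma> \<Gamma> (\<lambda>x. v \<bullet> (p x *\<^sub>R n x) + w \<bullet> (p x *\<^sub>R j (x - c) (n x)))"
      by (intro set_integral_add(1) set_integrable_inner_right int_A int_B)
    then show "set_borel_measurable \<sigma> \<Gamma> (\<lambda>x. v \<bullet> (p x *\<^sub>R n x) + w \<bullet> (p x *\<^sub>R j (x - c) (n x)))"
      unfolding set_integrable_def set_borel_measurable_def by blast
    show "AE x in \<sigma>. x \<in> \<Gamma> \<longrightarrow>
        p x * (U x \<bullet> n x) = v \<bullet> (p x *\<^sub>R n x) + w \<bullet> (p x *\<^sub>R j (x - c) (n x))"
      using on_\<Gamma> by eventually_elim (simp add: algebra_simps)
    show "AE x in \<sigma>. x \<in> \<Gamma>' \<longrightarrow> p x * (U x \<bullet> n x) = 0"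
      using on_\<Gamma>' by eventually_elim simp
  qed
  also have "\<dots> = (LINT x:\<Gamma>|\<sigma>. v \<bullet> (p x *\<^sub>R n x)) + (LINT x:\<Gamma>|\<sigma>. w \<bullet> (p x *\<^sub>R j (x - c) (n x)))"
    by (intro set_integral_add(2) set_integrable_inner_right int_A int_B)
  finally show ?thesis
    unfolding set_integral_inner_right[OF int_A] set_integral_inner_right[OF int_B] .
qed

lemma ipE_pressure_projection:
  fixes \<Omega> :: "(real^'n) set" and j :: "real^'n \<Rightarrow> real^'n \<Rightarrow> 'k::euclidean_space"
    and Iop Linv :: "'k \<Rightarrow> 'k" and p :: "real^'n \<Rightarrow> real" and U Ustar :: "real^'n \<Rightarrow> real^'n"
  assumes "open \<Omega>" "bounded \<Omega>" and parts: "frontier \<Omega> = \<Gamma> \<union> \<Gamma>'" "\<Gamma> \<inter> \<Gamma>' = {}" "closed \<Gamma>"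
    and normal: "outward_normal \<Omega> \<sigma> n" and "\<rho> > 0" "m > 0"
    and Iop: "linear Iop" "\<And>a b. a \<bullet> Iop b = b \<bullet> Iop a" "\<And>a. a \<noteq> 0 \<Longrightarrow> 0 < a \<bullet> Iop a"
      "\<And>z. Iop (Linv z) = z"
    and "bilinear j"
    and p: "C1_near (closure \<Omega>) p" and U: "C1_near (closure \<Omega>) U"
    and Ustar: "\<forall>x\<in>\<Omega>. Ustar x = U x + (1/\<rho>) *\<^sub>R grad p x"
    and vstar: "vstar = v + (- (1/m) *\<^sub>R (LINT x:\<Gamma>|\<sigma>. p x *\<^sub>R n x))"
    and wstar: "wstar = w + (- Linv (LINT x:\<Gamma>|\<sigma>. p x *\<^sub>R j (x - c) (n x)))"
    and div_free: "\<forall>x\<in>\<Omega>. divergence U x = 0"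
    and on_\<Gamma>: "AE x in \<sigma>. x \<in> \<Gamma> \<longrightarrow> U x \<bullet> n x = v \<bullet> n x + w \<bullet> j (x - c) (n x)"
    and on_\<Gamma>': "AE x in \<sigma>. x \<in> \<Gamma>' \<longrightarrow> U x \<bullet> n x = 0"
  shows "ipE \<Omega> \<rho> m Iop (U, v, w)
        (\<lambda>x. (1/\<rho>) *\<^sub>R grad p x, - (1/m) *\<^sub>R (LINT x:\<Gamma>|\<sigma>. p x *\<^sub>R n x),
         - Linv (LINT x:\<Gamma>|\<sigma>. p x *\<^sub>R j (x - c) (n x))) = 0 \<and>
     ipE \<Omega> \<rho> m Iop (Ustar, vstar, wstar) (Ustar, vstar, wstar) \<ge> ipE \<Omega> \<rho> m Iop (U, v, w) (U, v, w)"
proof -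
  define Y where "Y = (\<lambda>x. (1/\<rho>) *\<^sub>R grad p x, - (1/m) *\<^sub>R (LINT x:\<Gamma>|\<sigma>. p x *\<^sub>R n x),
    - Linv (LINT x:\<Gamma>|\<sigma>. p x *\<^sub>R j (x - c) (n x)))"
  have orthogonal: "ipE \<Omega> \<rho> m Iop (U, v, w) Y = 0"
    unfolding Y_def using \<open>\<rho> > 0\<close> \<open>m > 0\<close> Iop(1,4)
    by (intro ipE_pressure_orthogonal integral_grad_inner_rigid_boundary) (use assms in auto)
  have integrable: "set_integrable lebesgue \<Omega> (\<lambda>x. f x \<bullet> g x)"
    if "continuous_on (closure \<Omega>) f" "continuous_on (closure \<Omega>) g" for f g :: "real^'n \<Rightarrow> real^'n"
    using that by (intro set_integrable_continuous_on_closure[OF \<open>bounded \<Omega>\<close> \<open>open \<Omega>\<close>]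
        continuous_on_inner)
  have "continuous_on (closure \<Omega>) (\<lambda>x. (1/\<rho>) *\<^sub>R grad p x)"
    using C1_near_continuous_on_grad[OF p] by (rule continuous_on_scaleR[OF continuous_on_const])
  with C1_near_continuous_on[OF U]
  have "ipE \<Omega> \<rho> m Iop (Ustar, vstar, wstar) (Ustar, vstar, wstar)
      = ipE \<Omega> \<rho> m Iop (U, v, w) (U, v, w) + 2 * ipE \<Omega> \<rho> m Iop (U, v, w) Y + ipE \<Omega> \<rho> m Iop Y Y"
    unfolding Y_def vstar wstar
    using Ustar \<open>open \<Omega>\<close> Iop(1,2) by (intro ipE_add_self integrable) auto
  moreover have "0 \<le> a \<bullet> Iop a" for a
    using Iop(3)[of a] by (cases "a = 0") auto
  then have "0 \<le> ipE \<Omega> \<rho> m Iop Y Y"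
    using \<open>\<rho> > 0\<close> \<open>m > 0\<close> by (intro ipE_self_nonneg) auto
  ultimately show ?thesis
    using orthogonal unfolding Y_def by simp
qed

section \<open>Inertia and moments in two and three dimensions\<close>

lemma symmetric_matrix_inner_commute:
  fixes A :: "real^'n^'n"
  assumes "transpose A = A"
  shows "x \<bullet> (A *v y) = y \<bullet> (A *v x)"
  by (metis assms dot_lmul_matrix inner_commute vector_transpose_matrix)

lemma pos_def_matrix_right_inverse:
  fixes A :: "real^'n^'n"
  assumes "\<forall>x. x \<noteq> 0 \<longrightarrow> 0 < x \<bullet> (A *v x)"
  shows "A *v (matrix_inv A *v z) = z"
proof -
  have "inj ((*v) A)"
  proof (rule injI)
    fix x y assume "A *v x = A *v y"
    then have "A *v (x - y) = 0" by (simp add: matrix_vector_mult_diff_distrib)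
    then show "x = y" using assms[rule_format, of "x - y"] by (cases "x - y = 0") auto
  qed
  then have "invertible A"
    using invertible_left_inverse matrix_left_invertible_injective by blast
  then have "A ** matrix_inv A = mat 1"
    unfolding invertible_def matrix_inv_def
    by (rule someI_ex[where P = "\<lambda>A'. A ** A' = mat 1 \<and> A' ** A = mat 1", THEN conjunct1])
  then show ?thesis by (simp add: matrix_vector_mul_assoc)
qed

lemma bilinear_cross2: "bilinear cross2"
  unfolding bilinear_def cross2_def by (auto intro!: linearI simp: algebra_simps)

theorem theorem2p2:
  shows
  "(\<forall>(\<Omega>::(real^3) set) \<Gamma> \<Gamma>' \<sigma> n \<rho> m (c::real^3) (I::real^3^3)
       (Ustar::real^3 \<Rightarrow> real^3) vstar wstar U v w p.
     bounded_domain \<Omega> \<and> frontier \<Omega> = \<Gamma> \<union> \<Gamma>' \<and> \<Gamma> \<inter> \<Gamma>' = {} \<and>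
     (\<exists>S. bounded_domain S \<and> frontier S = \<Gamma>) \<and>
     outward_normal \<Omega> \<sigma> n \<and> \<rho> > 0 \<and> m > 0 \<and>
     transpose I = I \<and> (\<forall>x. x \<noteq> 0 \<longrightarrow> x \<bullet> (I *v x) > 0) \<and>
     C1_near (closure \<Omega>) p \<and> C1_near (closure \<Omega>) U \<and>
     (\<forall>x\<in>\<Omega>. Ustar x = U x + (1/\<rho>) *\<^sub>R grad p x) \<and>
     vstar = v + (- (1/m) *\<^sub>R (LINT x:\<Gamma>|\<sigma>. p x *\<^sub>R n x)) \<and>
     wstar = w + (- (matrix_inv I *v (LINT x:\<Gamma>|\<sigma>. p x *\<^sub>R cross3 (x - c) (n x)))) \<and>
     (\<forall>x\<in>\<Omega>. divergence U x = 0) \<and>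
     (AE x in \<sigma>. x \<in> \<Gamma> \<longrightarrow> U x \<bullet> n x = v \<bullet> n x + w \<bullet> cross3 (x - c) (n x)) \<and>
     (AE x in \<sigma>. x \<in> \<Gamma>' \<longrightarrow> U x \<bullet> n x = 0)
   \<longrightarrow>
     ipE \<Omega> \<rho> m ((*v) I) (U, v, w)
        (\<lambda>x. (1/\<rho>) *\<^sub>R grad p x,
         - (1/m) *\<^sub>R (LINT x:\<Gamma>|\<sigma>. p x *\<^sub>R n x),
         - (matrix_inv I *v (LINT x:\<Gamma>|\<sigma>. p x *\<^sub>R cross3 (x - c) (n x)))) = 0 \<and>
     ipE \<Omega> \<rho> m ((*v) I) (Ustar, vstar, wstar) (Ustar, vstar, wstar)
       \<ge> ipE \<Omega> \<rho> m ((*v) I) (U, v, w) (U, v, w))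
 \<and>
  (\<forall>(\<Omega>::(real^2) set) \<Gamma> \<Gamma>' \<sigma> n \<rho> m (c::real^2) (I::real)
       (Ustar::real^2 \<Rightarrow> real^2) vstar (wstar::real) U v w p.
     bounded_domain \<Omega> \<and> frontier \<Omega> = \<Gamma> \<union> \<Gamma>' \<and> \<Gamma> \<inter> \<Gamma>' = {} \<and>
     (\<exists>S. bounded_domain S \<and> frontier S = \<Gamma>) \<and>
     outward_normal \<Omega> \<sigma> n \<and> \<rho> > 0 \<and> m > 0 \<and> I > 0 \<and>
     C1_near (closure \<Omega>) p \<and> C1_near (closure \<Omega>) U \<and>
     (\<forall>x\<in>\<Omega>. Ustar x = U x + (1/\<rho>) *\<^sub>R grad p x) \<and>
     vstar = v + (- (1/m) *\<^sub>R (LINT x:\<Gamma>|\<sigma>. p x *\<^sub>R n x)) \<and>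
     wstar = w + (- ((1/I) * (LINT x:\<Gamma>|\<sigma>. p x * cross2 (x - c) (n x)))) \<and>
     (\<forall>x\<in>\<Omega>. divergence U x = 0) \<and>
     (AE x in \<sigma>. x \<in> \<Gamma> \<longrightarrow> U x \<bullet> n x = v \<bullet> n x + w * cross2 (x - c) (n x)) \<and>
     (AE x in \<sigma>. x \<in> \<Gamma>' \<longrightarrow> U x \<bullet> n x = 0)
   \<longrightarrow>
     ipE \<Omega> \<rho> m ((*) I) (U, v, w)
        (\<lambda>x. (1/\<rho>) *\<^sub>R grad p x,
         - (1/m) *\<^sub>R (LINT x:\<Gamma>|\<sigma>. p x *\<^sub>R n x),
         - ((1/I) * (LINT x:\<Gamma>|\<sigma>. p x * cross2 (x - c) (n x)))) = 0 \<and>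
     ipE \<Omega> \<rho> m ((*) I) (Ustar, vstar, wstar) (Ustar, vstar, wstar)
       \<ge> ipE \<Omega> \<rho> m ((*) I) (U, v, w) (U, v, w))"
  apply (rule conjI; intro allI impI; elim conjE exE)
  subgoal for \<Omega> \<Gamma> \<Gamma>' \<sigma> n \<rho> m c I Ustar vstar wstar U v w p S
    by (rule ipE_pressure_projection[where j = cross3 and Linv = "(*v) (matrix_inv I)"])
      (auto simp: bounded_domain_def symmetric_matrix_inner_commute pos_def_matrix_right_inverse
        bilinear_cross)
  \<comment> \<open>planar angular velocities and moments are reals, so \<open>\<bullet>\<close> and \<open>*\<^sub>R\<close> become \<open>*\<close>\<close>
  subgoal for \<Omega> \<Gamma> \<Gamma>' \<sigma> n \<rho> m c I Ustar vstar wstar U v w p S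
    by (rule ipE_pressure_projection[where j = cross2 and Linv = "(*) (1/I)",
          unfolded inner_real_def real_scaleR_def])
      (auto simp: bounded_domain_def bilinear_cross2 zero_less_mult_iff mult_less_0_iff)
  done

end
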